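(* Let $\mathcal{S}$ be a (finite) set of Pauli operators on a common system of qubits, and let $\mathcal{T}\subseteq\mathcal{S}$ be the set obtained by removing from $\mathcal{S}$ every operator that commutes with all others in $\mathcal{S}$. Then $\mathcal{S}$ is noncontextual if and only if commutation is an equivalence relation on $\mathcal{T}$.
   Context: Pauli operators: fix a number of qubits $N\ge 1$. A Pauli operator is an operator $\pm\, P_1\otimes\cdots\otimes P_N$ with each $P_i\in\{I,X,Y,Z\}$ (the $2\times 2$ identity and the Pauli matrices). Any two Pauli operators either commute or anticommute, and each squares to the identity. Operators are compared including their sign, so $A$ and $-A$ are different operators. Determining tree: a determining tree for a Pauli operator $A$ over a set $\mathcal{S}$ of Pauli operators is a finite rooted tree whose nodes are (labelled by) Pauli operators, with repetitions allowed, and whose leaves are operators in $\mathcal{S}$, such that (1) the root is $A$; (2) all children of any particular parent pairwise commute as operators; (3) every parent node is the operator product of its children. (A single node $B\in\mathcal{S}$ is a determining tree for $B$.) Determining set: the determining set of a determining tree is the set containing one copy of each operator that occurs with odd multiplicity as a leaf of the tree. Contextual: a set $\mathcal{S}$ of Pauli operators is contextual if for some Pauli operator $A$ there exist a determining tree $\tau$ for $A$ over $\mathcal{S}$ and a determining tree $\tau'$ for $-A$ over $\mathcal{S}$ such that the determining sets of $\tau$ and $\tau'$ are identical. Otherwise it is noncontextual. Commutation on $\mathcal{T}$ is the relation $A\sim B$ if and only if $AB=BA$, for $A,B\in\mathcal{T}$. *)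

theory Defs
  imports "HOL-Analysis.Analysis" "HOL-Library.Multiset"
begin

text \<open>
  The qubits are labelled by a finite type \<open>'n\<close>, so their number is \<open>CARD('n) \<ge> 1\<close>.
  A computational basis state of a single qubit is a \<open>bool\<close> (\<open>False\<close> for 0, \<open>True\<close> for 1), and
  one of the whole system is a function \<open>'n \<Rightarrow> bool\<close>. Operators are matrices in this basis; the
  operator product is \<open>**\<close> (not \<open>*\<close>, which acts componentwise on vectors).
\<close>

type_synonym qubit_op = "complex ^ bool ^ bool"
type_synonym 'n qubits_op = "complex ^ ('n \<Rightarrow> bool) ^ ('n \<Rightarrow> bool)"

definition pauli_I :: qubit_op where
  "pauli_I = mat 1"

definition pauli_X :: qubit_op where
  "pauli_X = (\<chi> a b. if a = b then 0 else 1)"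

definition pauli_Y :: qubit_op where
  "pauli_Y = (\<chi> a b. if a = b then 0 else if a then \<i> else - \<i>)"

definition pauli_Z :: qubit_op where
  "pauli_Z = (\<chi> a b. if a = b then (if a then - 1 else 1) else 0)"

text \<open>The matrix entries of a tensor product are the products of the entries of its factors.\<close>

definition tensor_op :: "('n::finite \<Rightarrow> qubit_op) \<Rightarrow> 'n qubits_op" where
  "tensor_op P = (\<chi> x y. \<Prod>i\<in>UNIV. P i $ x i $ y i)"

definition pauli_operator :: "('n::finite) qubits_op \<Rightarrow> bool" where
  "pauli_operator A \<longleftrightarrow>
     (\<exists>P. (\<forall>i. P i \<in> {pauli_I, pauli_X, pauli_Y, pauli_Z}) \<and>
          (A = tensor_op P \<or> A = - tensor_op P))"

definition commuting :: "('n::finite) qubits_op \<Rightarrow> 'n qubits_op \<Rightarrow> bool" where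
  "commuting A B \<longleftrightarrow> A ** B = B ** A"

definition op_prod :: "('n::finite) qubits_op list \<Rightarrow> 'n qubits_op" where
  "op_prod As = foldr (**) As (mat 1)"

text \<open>
  A leaf is a node whose list of children is empty. The order of the children is immaterial in a
  determining tree, since siblings commute.
\<close>

datatype 'a tree = Node (label: 'a) (children: "'a tree list")

primrec leaves :: "'a tree \<Rightarrow> 'a multiset" where
  "leaves (Node a ts) = (if ts = [] then {#a#} else sum_list (map leaves ts))"

primrec determining_tree_over :: "('n::finite) qubits_op set \<Rightarrow> 'n qubits_op tree \<Rightarrow> bool" where
  "determining_tree_over S (Node A ts) \<longleftrightarrow>
     pauli_operator A \<and>
     (if ts = [] then A \<in> S
      else (\<forall>s\<in>set ts. \<forall>t\<in>set ts. commuting (label s) (label t)) \<and>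
           A = op_prod (map label ts) \<and>
           list_all (determining_tree_over S) ts)"

definition determining_tree ::
    "('n::finite) qubits_op set \<Rightarrow> 'n qubits_op \<Rightarrow> 'n qubits_op tree \<Rightarrow> bool" where
  "determining_tree S A \<tau> \<longleftrightarrow> label \<tau> = A \<and> determining_tree_over S \<tau>"

definition determining_set :: "'a tree \<Rightarrow> 'a set" where
  "determining_set \<tau> = {B. odd (count (leaves \<tau>) B)}"

definition contextual :: "('n::finite) qubits_op set \<Rightarrow> bool" where
  "contextual S \<longleftrightarrow>
     (\<exists>A \<tau> \<tau>'. pauli_operator A \<and> determining_tree S A \<tau> \<and> determining_tree S (- A) \<tau>' \<and>
               determining_set \<tau> = determining_set \<tau>')"

abbreviation noncontextual :: "('n::finite) qubits_op set \<Rightarrow> bool" where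
  "noncontextual S \<equiv> \<not> contextual S"

definition remove_central :: "('n::finite) qubits_op set \<Rightarrow> 'n qubits_op set" where
  "remove_central S = S - {A \<in> S. \<forall>B\<in>S - {A}. commuting A B}"

definition commutation_on :: "('n::finite) qubits_op set \<Rightarrow> ('n qubits_op \<times> 'n qubits_op) set" where
  "commutation_on T = {(A, B). A \<in> T \<and> B \<in> T \<and> commuting A B}"

end

theory Submission
  imports Defs
begin

text \<open>
  Suppose commutation is not transitive on \<open>T\<close>: \<open>A\<close> and \<open>C\<close> commute with \<open>B\<close> but not with each
  other, and some \<open>D \<in> S\<close> anticommutes with \<open>B\<close>. One of \<open>D\<close>, \<open>AD\<close>, \<open>CD\<close>, \<open>CABD\<close> is the root \<open>X\<close> of a
  determining tree and commutes with \<open>A\<close> and \<open>C\<close> but not with \<open>B\<close>. Then \<open>(AB)(CX)\<close> and \<open>(AX)(BC)\<close> are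
  products of commuting operators with the same leaves and opposite signs (a Mermin square).

  Suppose conversely that commutation is an equivalence relation on \<open>T\<close>, and choose a representative
  \<open>r B\<close> of the class of each \<open>B \<in> T\<close>. The operator \<open>g B = (r B) B\<close> commutes with all of \<open>S\<close>, and
  distinct representatives anticommute. Hence the root of a determining tree is \<open>U\<close> times the product
  of the \<open>g B\<close> over the leaves \<open>B\<close> (with \<open>g B = B\<close> off \<open>T\<close>), where \<open>U\<close> is \<open>1\<close> or a representative. As
  the \<open>g B\<close> are commuting involutions, this product depends only on the determining set; and \<open>U\<close> and
  \<open>- U\<close> cannot both be admissible, so the determining set fixes the sign of the root.
\<close>

section \<open>Commutation and products of Pauli operators\<close>

text \<open>Distributivity: the sum over all intermediate states \<open>z\<close> of products over
  qubits is the product of the one-qubit sums.\<close>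

lemma tensor_op_mult: "tensor_op P ** tensor_op Q = tensor_op (\<lambda>i. P i ** Q i)"
proof -
  have "(\<Sum>z\<in>UNIV. (\<Prod>i\<in>UNIV. P i $ x i $ z i) * (\<Prod>i\<in>UNIV. Q i $ z i $ y i))
      = (\<Prod>i\<in>UNIV. \<Sum>b\<in>UNIV. P i $ x i $ b * Q i $ b $ y i)" for x y :: "'a \<Rightarrow> bool"
    using prod_sum_PiE[of UNIV "\<lambda>_. UNIV" "\<lambda>i b. P i $ x i $ b * Q i $ b $ y i"]
    by (simp add: prod.distrib PiE_UNIV_domain)
  then show ?thesis
    by (simp add: tensor_op_def matrix_matrix_mult_def vec_eq_iff)
qed

text \<open>Phases such as \<open>\<i>\<close> are complex, whereas \<open>*\<^sub>R\<close> scales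
  by reals; hence the entrywise form.\<close>

lemma tensor_op_scale:
  "tensor_op (\<lambda>i. \<chi> a b. c i * P i $ a $ b) = (\<chi> x y. (\<Prod>i\<in>UNIV. c i) * tensor_op P $ x $ y)"
  by (simp add: tensor_op_def vec_eq_iff prod.distrib)

lemmas pauli_defs = pauli_I_def pauli_X_def pauli_Y_def pauli_Z_def

lemma tensor_op_I: "tensor_op (\<lambda>_. pauli_I) = mat 1"
proof -
  have "(\<Prod>i\<in>UNIV. if x i = y i then 1 else (0::complex)) = (if x = y then 1 else 0)"
    for x y :: "'a \<Rightarrow> bool"
    by (auto simp: fun_eq_iff prod_zero_iff)
  then show ?thesis
    by (simp add: tensor_op_def pauli_I_def mat_def vec_eq_iff)
qed

abbreviation paulis :: "qubit_op set" where
  "paulis \<equiv> {pauli_I, pauli_X, pauli_Y, pauli_Z}"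

lemma paulis_square: "P \<in> paulis \<Longrightarrow> P ** P = pauli_I"
  by (auto simp: pauli_defs vec_eq_iff matrix_matrix_mult_def mat_def UNIV_bool)

lemma pauli_mult_table:
  "pauli_X ** pauli_Y = (\<chi> a b. \<i> * pauli_Z $ a $ b)"
  "pauli_Y ** pauli_X = (\<chi> a b. - \<i> * pauli_Z $ a $ b)"
  "pauli_Y ** pauli_Z = (\<chi> a b. \<i> * pauli_X $ a $ b)"
  "pauli_Z ** pauli_Y = (\<chi> a b. - \<i> * pauli_X $ a $ b)"
  "pauli_Z ** pauli_X = (\<chi> a b. \<i> * pauli_Y $ a $ b)"
  "pauli_X ** pauli_Z = (\<chi> a b. - \<i> * pauli_Y $ a $ b)"
  by (simp_all add: pauli_defs matrix_matrix_mult_def UNIV_bool vec_eq_iff all_bool_eq)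

lemma paulis_mult_scaled:
  assumes "P \<in> paulis" "Q \<in> paulis"
  shows "\<exists>c. \<exists>R\<in>paulis. P ** Q = (\<chi> a b. c * R $ a $ b)"
proof -
  have triv: "M = (\<chi> a b. 1 * M $ a $ b)" for M :: qubit_op
    by simp
  consider "P = pauli_I" | "Q = pauli_I" | "P = Q" | "P \<noteq> Q" "P \<noteq> pauli_I" "Q \<noteq> pauli_I"
    by blast
  then show ?thesis
  proof cases
    case 1
    then have "P ** Q = Q" by (simp add: pauli_I_def)
    then show ?thesis using assms triv by metis
  next
    case 2
    then have "P ** Q = P" by (simp add: pauli_I_def)
    then show ?thesis using assms triv by metis
  next
    case 3
    then have "P ** Q = pauli_I" using assms paulis_square by metis
    then show ?thesis using triv by (metis insertI1)
  next
    case 4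
    then show ?thesis using assms pauli_mult_table by (metis insert_iff empty_iff)
  qed
qed

text \<open>Two distinct Pauli matrices other than the identity anticommute; all remaining pairs
  commute.\<close>

lemma paulis_commute_upto_sign:
  assumes "P \<in> paulis" "Q \<in> paulis"
  shows "\<exists>s\<in>{1,-1::real}. P ** Q = s *\<^sub>R (Q ** P)"
proof (cases "P = pauli_I \<or> Q = pauli_I \<or> P = Q")
  case True
  then have "P ** Q = Q ** P"
    by (auto simp: pauli_I_def)
  then show ?thesis by simp
next
  case False
  have "pauli_X ** pauli_Y = - (pauli_Y ** pauli_X)"
    "pauli_Y ** pauli_Z = - (pauli_Z ** pauli_Y)"
    "pauli_Z ** pauli_X = - (pauli_X ** pauli_Z)"
    by (simp_all add: pauli_mult_table vec_eq_iff)
  then have "P ** Q = - (Q ** P)"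
    using False assms by (metis insert_iff empty_iff minus_minus)
  then show ?thesis by simp
qed

lemma tensor_op_scaleR: "tensor_op (\<lambda>i. s i *\<^sub>R P i) = (\<Prod>i\<in>UNIV. s i) *\<^sub>R tensor_op P"
  by (simp add: tensor_op_def vec_eq_iff prod.distrib scaleR_conv_of_real[where 'a = complex])

lemma matrix_mult_uminus:
  fixes A B :: "('n::finite) qubits_op"
  shows "(- A) ** B = - (A ** B)" "A ** (- B) = - (A ** B)"
  by (simp_all add: matrix_matrix_mult_def vec_eq_iff sum_negf)

lemma pauli_operator_cases:
  assumes "pauli_operator A"
  obtains P where "\<forall>i. P i \<in> paulis" "A = tensor_op P \<or> A = - tensor_op P"
  using assms unfolding pauli_operator_def by blast

lemma pauli_operator_square:
  assumes "pauli_operator A" shows "A ** A = mat 1"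
proof -
  obtain P where P: "\<forall>i. P i \<in> paulis" "A = tensor_op P \<or> A = - tensor_op P"
    using assms by (rule pauli_operator_cases)
  have "tensor_op P ** tensor_op P = mat 1"
    unfolding tensor_op_mult using P(1) by (simp only: paulis_square tensor_op_I)
  then show ?thesis
    using P(2) by (auto simp: matrix_mult_uminus)
qed

text \<open>Treats commuting (\<open>s = 1\<close>) and anticommuting (\<open>s = -1\<close>)
  uniformly, so that signs multiply when operators do.\<close>

definition twisted :: "real \<Rightarrow> ('n::finite) qubits_op \<Rightarrow> 'n qubits_op \<Rightarrow> bool" where
  "twisted s A B \<longleftrightarrow> A ** B = s *\<^sub>R (B ** A)"

lemma commuting_iff_twisted: "commuting A B \<longleftrightarrow> twisted 1 A B"
  by (simp add: commuting_def twisted_def)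

lemma pauli_operator_twisted:
  assumes "pauli_operator A" "pauli_operator B"
  shows "\<exists>s\<in>{1,-1}. twisted s A B"
proof -
  obtain P where P: "\<forall>i. P i \<in> paulis" "A = tensor_op P \<or> A = - tensor_op P"
    using assms(1) by (rule pauli_operator_cases)
  obtain Q where Q: "\<forall>i. Q i \<in> paulis" "B = tensor_op Q \<or> B = - tensor_op Q"
    using assms(2) by (rule pauli_operator_cases)
  have "\<forall>i. \<exists>s. s \<in> {1,-1::real} \<and> P i ** Q i = s *\<^sub>R (Q i ** P i)"
    using paulis_commute_upto_sign P(1) Q(1) unfolding Bex_def by presburger
  then obtain s where s: "\<forall>i. s i \<in> {1,-1::real} \<and> P i ** Q i = s i *\<^sub>R (Q i ** P i)"
    unfolding choice_iff ..
  have sign: "(\<Prod>i\<in>I. s i) \<in> {1,-1}" if "finite I" for I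
    using that by induction (use s in auto)
  have "tensor_op P ** tensor_op Q = (\<Prod>i\<in>UNIV. s i) *\<^sub>R (tensor_op Q ** tensor_op P)"
    unfolding tensor_op_mult tensor_op_scaleR[symmetric] using s by presburger
  then have "twisted (\<Prod>i\<in>UNIV. s i) A B"
    using P(2) Q(2) unfolding twisted_def by (auto simp: matrix_mult_uminus)
  then show ?thesis by (rule bexI) (rule sign[OF finite])
qed

text \<open>Multiplying qubit by qubit gives a Pauli tensor product times a phase \<open>d\<close>.
  As \<open>A\<close> and \<open>B\<close> commute, \<open>A ** B\<close> squares to the identity,
  so \<open>d\<close> is \<open>1\<close> or \<open>-1\<close> and not \<open>\<i>\<close> or
  \<open>- \<i>\<close>.\<close>

lemma pauli_operator_mult:
  assumes "pauli_operator A" "pauli_operator B" "commuting A B"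
  shows "pauli_operator (A ** B)"
proof -
  obtain P where P: "\<forall>i. P i \<in> paulis" "A = tensor_op P \<or> A = - tensor_op P"
    using assms(1) by (rule pauli_operator_cases)
  obtain Q where Q: "\<forall>i. Q i \<in> paulis" "B = tensor_op Q \<or> B = - tensor_op Q"
    using assms(2) by (rule pauli_operator_cases)
  have "\<forall>i. \<exists>c R. R \<in> paulis \<and> P i ** Q i = (\<chi> a b. c * R $ a $ b)"
    using paulis_mult_scaled P(1) Q(1) unfolding Bex_def by presburger
  then obtain c R where R: "\<forall>i. R i \<in> paulis \<and> P i ** Q i = (\<chi> a b. c i * R i $ a $ b)"
    unfolding choice_iff by (elim exE) (rule that)
  then have Rp: "\<forall>i. R i \<in> paulis"
    by presburger
  define d where "d = (\<Prod>i\<in>UNIV. c i)"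
  have prod: "tensor_op P ** tensor_op Q = (\<chi> x y. d * tensor_op R $ x $ y)"
    unfolding tensor_op_mult d_def tensor_op_scale[symmetric] using R by presburger
  have "pauli_operator (tensor_op R)"
    using Rp unfolding pauli_operator_def by (intro exI[of _ R] conjI) simp_all
  then have RR: "tensor_op R ** tensor_op R = mat 1"
    by (rule pauli_operator_square)
  moreover have "(\<chi> x y. d * tensor_op R $ x $ y) ** (\<chi> x y. d * tensor_op R $ x $ y)
      = (\<chi> x y. d\<^sup>2 * (tensor_op R ** tensor_op R) $ x $ y)"
    by (simp add: matrix_matrix_mult_def vec_eq_iff sum_distrib_left power2_eq_square mult_ac)
  moreover have "(A ** B) ** (A ** B) = mat 1"
    using assms by (metis commuting_def matrix_mul_assoc matrix_mul_rid pauli_operator_square)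
  then have "(tensor_op P ** tensor_op Q) ** (tensor_op P ** tensor_op Q) = mat 1"
    using P(2) Q(2) by (auto simp: matrix_mult_uminus)
  ultimately have sq: "(\<chi> x y. d\<^sup>2 * (mat 1 :: 'a qubits_op) $ x $ y) = mat 1"
    by (simp add: prod)
  have "d\<^sup>2 = 1"
    \<comment> \<open>Compares one diagonal entry; \<open>undefined\<close> is an arbitrary basis
      state.\<close>
    using arg_cong[OF sq, of "\<lambda>M. M $ undefined $ undefined"] by (simp add: mat_def)
  then have "d = 1 \<or> d = -1"
    by (simp add: power2_eq_1_iff)
  then have "tensor_op P ** tensor_op Q = tensor_op R \<or> tensor_op P ** tensor_op Q = - tensor_op R"
    unfolding prod by (auto simp: vec_eq_iff)
  then have "A ** B = tensor_op R \<or> A ** B = - tensor_op R"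
    using P(2) Q(2) by (auto simp: matrix_mult_uminus)
  then show ?thesis
    using Rp unfolding pauli_operator_def by (intro exI[of _ R] conjI) simp_all
qed

section \<open>Multiplicativity of commutation signs\<close>

lemma twisted_sym:
  assumes "twisted s A B" "s \<in> {1,-1}" shows "twisted s B A"
  using assms by (auto simp: twisted_def)

lemma twisted_mult_right:
  assumes "twisted s A B" "twisted t A C"
  shows "twisted (s * t) A (B ** C)"
proof -
  have "A ** (B ** C) = s *\<^sub>R (B ** (A ** C))"
    using assms(1) by (simp add: twisted_def matrix_mul_assoc scalar_matrix_assoc)
  also have "\<dots> = s *\<^sub>R (B ** (t *\<^sub>R (C ** A)))"
    using assms(2) by (simp add: twisted_def)
  also have "\<dots> = (s * t) *\<^sub>R ((B ** C) ** A)"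
    by (simp add: matrix_scalar_ac matrix_mul_assoc flip: scalar_matrix_assoc)
  finally show ?thesis by (simp add: twisted_def)
qed

lemma twisted_mult_left:
  assumes "twisted s A C" "twisted t B C"
  shows "twisted (s * t) (A ** B) C"
proof -
  have "(A ** B) ** C = t *\<^sub>R ((A ** C) ** B)"
    using assms(2) by (simp add: twisted_def matrix_scalar_ac flip: matrix_mul_assoc scalar_matrix_assoc)
  also have "\<dots> = (s * t) *\<^sub>R (C ** (A ** B))"
    using assms(1) by (simp add: twisted_def matrix_mul_assoc flip: scalar_matrix_assoc)
  finally show ?thesis by (simp add: twisted_def)
qed

lemma commuting_refl: "commuting A A"
  and commuting_sym: "commuting A B \<Longrightarrow> commuting B A"
  and commuting_one: "commuting A (mat 1)" "commuting (mat 1) A"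
  by (simp_all add: commuting_def)

lemma commuting_mult_right: "commuting A B \<Longrightarrow> commuting A C \<Longrightarrow> commuting A (B ** C)"
  using twisted_mult_right[of 1 A B 1 C] by (simp add: commuting_iff_twisted)

lemma commuting_mult_left: "commuting A C \<Longrightarrow> commuting B C \<Longrightarrow> commuting (A ** B) C"
  using twisted_mult_left[of 1 A C 1 B] by (simp add: commuting_iff_twisted)

lemma matrix_mult_interchange:
  assumes "commuting P B" shows "(A ** P) ** (B ** Q) = (A ** B) ** (P ** Q)"
proof -
  have "(A ** P) ** (B ** Q) = A ** (P ** B) ** Q"
    by (simp only: matrix_mul_assoc)
  also have "\<dots> = A ** (B ** P) ** Q"
    using assms by (simp only: commuting_def)
  finally show ?thesis
    by (simp only: matrix_mul_assoc)
qed

lemma pauli_operator_anticommute: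
  assumes "pauli_operator A" "pauli_operator B" "\<not> commuting A B"
  shows "twisted (-1) A B"
  using pauli_operator_twisted[OF assms(1,2)] assms(3) by (auto simp: commuting_iff_twisted)

section \<open>Determining trees and the Mermin square\<close>

text \<open>Defined on multisets so that it also applies to the joint leaves of several subtrees;
  sums become symmetric differences.\<close>

definition odd_part :: "'a multiset \<Rightarrow> 'a set" where
  "odd_part M = {B. odd (count M B)}"

lemma odd_part_simps:
  "odd_part {#} = {}" "odd_part {#B#} = {B}" "odd_part (M + N) = sym_diff (odd_part M) (odd_part N)"
  by (auto simp: odd_part_def)

lemma determining_set_conv: "determining_set \<tau> = odd_part (leaves \<tau>)"
  by (simp add: determining_set_def odd_part_def)

text \<open>Only the root and the leaf multiset of a tree matter when trees are combined.\<close>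

definition derivable ::
    "('n::finite) qubits_op set \<Rightarrow> 'n qubits_op \<Rightarrow> 'n qubits_op multiset \<Rightarrow> bool" where
  "derivable S A M \<longleftrightarrow> (\<exists>\<tau>. determining_tree S A \<tau> \<and> leaves \<tau> = M)"

lemma derivable_pauli_operator:
  assumes "derivable S A M" shows "pauli_operator A"
proof -
  obtain \<tau> where "label \<tau> = A" "determining_tree_over S \<tau>"
    using assms unfolding derivable_def determining_tree_def by blast
  then show ?thesis
    by (cases \<tau>) simp
qed

lemma derivable_leaf:
  assumes "A \<in> S" "pauli_operator A" shows "derivable S A {#A#}"
  unfolding derivable_def determining_tree_def
  by (rule exI[of _ "Node A []"]) (use assms in simp)

lemma derivable_mult:
  assumes "derivable S A M" "derivable S B N" "commuting A B"
  shows "derivable S (A ** B) (M + N)"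
proof -
  obtain \<sigma> \<tau> where t: "determining_tree S A \<sigma>" "leaves \<sigma> = M"
      "determining_tree S B \<tau>" "leaves \<tau> = N"
    using assms unfolding derivable_def by blast
  have "pauli_operator (A ** B)"
    using assms by (intro pauli_operator_mult derivable_pauli_operator)
  then show ?thesis
    unfolding derivable_def determining_tree_def
    by (intro exI[of _ "Node (A ** B) [\<sigma>, \<tau>]"])
      (use t assms(3) in \<open>auto simp: determining_tree_def op_prod_def commuting_def\<close>)
qed

lemma contextual_if_derivable:
  assumes "derivable S A M" "derivable S (- A) N" "odd_part M = odd_part N"
  shows "contextual S"
  using assms derivable_pauli_operator[OF assms(1)]
  unfolding contextual_def derivable_def determining_set_conv by metis

text \<open>Neighbours in the cycle \<open>A\<close>, \<open>B\<close>, \<open>C\<close>,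
  \<open>X\<close> commute and opposite operators anticommute. In each grouping the two pairs
  commute, as two sign changes cancel.\<close>

lemma mermin_square_contextual:
  assumes "derivable S A a" "derivable S B b" "derivable S C c" "derivable S X x"
    and AB: "twisted 1 A B" and BC: "twisted 1 B C" and CX: "twisted 1 C X" and AX: "twisted 1 A X"
    and AC: "twisted (-1) A C" and BX: "twisted (-1) B X"
  shows "contextual S"
proof -
  have sym: "twisted 1 X C" "twisted (-1) X B"
    using twisted_sym[OF CX] twisted_sym[OF BX] by simp_all
  have "derivable S ((A ** B) ** (C ** X)) ((a + b) + (c + x))"
    using assms twisted_mult_left[OF twisted_mult_right[OF AC AX] twisted_mult_right[OF BC BX]]
    by (intro derivable_mult) (simp_all add: commuting_iff_twisted)
  moreover have "derivable S ((A ** X) ** (B ** C)) ((a + x) + (b + c))"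
    using assms twisted_mult_left[OF twisted_mult_right[OF AB AC] twisted_mult_right[OF sym(2,1)]]
    by (intro derivable_mult) (simp_all add: commuting_iff_twisted)
  moreover have "(A ** X) ** (B ** C) = - ((A ** B) ** (C ** X))"
  proof -
    \<comment> \<open>The groupings differ by exchanging \<open>X\<close> with \<open>B\<close>,
      which costs the sign, and \<open>X\<close> with \<open>C\<close>, which is free.\<close>
    have "(A ** X) ** (B ** C) = A ** (X ** B) ** C"
      by (simp add: matrix_mul_assoc)
    also have "\<dots> = - (A ** B ** (X ** C))"
      using sym(2) by (simp add: twisted_def matrix_mult_uminus matrix_mul_assoc)
    also have "\<dots> = - ((A ** B) ** (C ** X))"
      using sym(1) by (simp add: twisted_def)
    finally show ?thesis .
  qed
  ultimately show ?thesis
    by (intro contextual_if_derivable) (auto simp: ac_simps)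
qed

lemma intransitive_contextual:
  assumes S: "\<forall>A\<in>S. pauli_operator A"
    and mem: "A \<in> S" "B \<in> S" "C \<in> S" "D \<in> S"
    and com: "commuting A B" "commuting B C" "\<not> commuting A C" "\<not> commuting B D"
  shows "contextual S"
proof -
  have der: "derivable S A {#A#}" "derivable S B {#B#}" "derivable S C {#C#}" "derivable S D {#D#}"
    using S mem derivable_leaf by blast+
  have AB: "twisted 1 A B" and BC: "twisted 1 B C"
    using com by (simp_all add: commuting_iff_twisted)
  have AC: "twisted (-1) A C" and BD: "twisted (-1) B D"
    using pauli_operator_anticommute S mem com by blast+
  have BA: "twisted 1 B A" and CB: "twisted 1 C B" and CA: "twisted (-1) C A"
    using AB BC AC by (auto intro: twisted_sym)
  have self: "twisted 1 M M" for M :: "'a qubits_op"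
    by (simp add: twisted_def)
  \<comment> \<open>Starting from \<open>D\<close>, a factor \<open>A\<close> flips the sign against
    \<open>C\<close> only, and a factor \<open>C\<close> flips the sign against \<open>A\<close>
    only. The signs \<open>s\<close> and \<open>t\<close> of \<open>A\<close> and \<open>C\<close>
    against \<open>D\<close> tell which factors are required.\<close>
  have "\<exists>X x. derivable S X x \<and> twisted 1 A X \<and> twisted 1 C X \<and> twisted (-1) B X"
  proof -
    obtain s where s: "s \<in> {1,-1}" "twisted s A D"
      using pauli_operator_twisted S mem by blast
    obtain t where t: "t \<in> {1,-1}" "twisted t C D"
      using pauli_operator_twisted S mem by blast
    consider "s = 1" "t = 1" | "s = 1" "t = -1" | "s = -1" "t = 1" | "s = -1" "t = -1"
      using s(1) t(1) by blast
    then show ?thesis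
    proof cases
      case 1
      then show ?thesis using s t BD der by blast
    next
      case 2
      have "derivable S (A ** D) ({#A#} + {#D#})"
        using der s 2 by (intro derivable_mult) (simp_all add: commuting_iff_twisted)
      moreover have "twisted 1 A (A ** D)" "twisted 1 C (A ** D)" "twisted (-1) B (A ** D)"
        using twisted_mult_right[OF self s(2)] twisted_mult_right[OF CA t(2)]
          twisted_mult_right[OF BA BD] 2 by simp_all
      ultimately show ?thesis by blast
    next
      case 3
      have "derivable S (C ** D) ({#C#} + {#D#})"
        using der t 3 by (intro derivable_mult) (simp_all add: commuting_iff_twisted)
      moreover have "twisted 1 A (C ** D)" "twisted 1 C (C ** D)" "twisted (-1) B (C ** D)"
        using twisted_mult_right[OF AC s(2)] twisted_mult_right[OF self t(2)]
          twisted_mult_right[OF BC BD] 3 by simp_all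
      ultimately show ?thesis by blast
    next
      case 4
      have AD: "twisted (-1) A D" and CD: "twisted (-1) C D"
        using s t 4 by simp_all
      \<comment> \<open>Neither \<open>A\<close> nor \<open>C\<close> may be joined to
        \<open>D\<close> directly here, as both anticommute with it. The extra factor
        \<open>B\<close> repairs this without affecting the signs against \<open>A\<close>,
        \<open>B\<close> and \<open>C\<close>.\<close>
      have AB_D: "twisted 1 (A ** B) D"
        using twisted_mult_left[OF AD BD] by simp
      have "derivable S ((A ** B) ** D) ({#A#} + {#B#} + {#D#})"
        using der AB AB_D by (intro derivable_mult) (simp_all add: commuting_iff_twisted)
      moreover have C_ABD: "twisted 1 C ((A ** B) ** D)"
        using twisted_mult_right[OF twisted_mult_right[OF CA CB] CD] by simp
      ultimately have "derivable S (C ** ((A ** B) ** D)) ({#C#} + ({#A#} + {#B#} + {#D#}))"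
        using C_ABD by (intro derivable_mult[OF der(3)]) (simp_all add: commuting_iff_twisted)
      moreover have "twisted 1 A (C ** ((A ** B) ** D))"
        using twisted_mult_right[OF AC twisted_mult_right[OF twisted_mult_right[OF self AB] AD]]
        by simp
      moreover have "twisted 1 C (C ** ((A ** B) ** D))"
        using twisted_mult_right[OF self C_ABD] by simp
      moreover have "twisted (-1) B (C ** ((A ** B) ** D))"
        using twisted_mult_right[OF BC twisted_mult_right[OF twisted_mult_right[OF BA self] BD]]
        by simp
      ultimately show ?thesis by blast
    qed
  qed
  then show ?thesis
    using mermin_square_contextual[OF der(1-3)] AB BC AC by blast
qed

section \<open>Roots are determined by determining sets\<close>

lemma commuting_op_prod: "(\<And>B. B \<in> set Bs \<Longrightarrow> commuting A B) \<Longrightarrow> commuting A (op_prod Bs)"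
  by (induction Bs) (simp_all add: op_prod_def commuting_one commuting_mult_right)

text \<open>The list fixes an order, as \<open>**\<close> is not commutative. Padding with
  \<open>mat 1\<close> aligns the factors of any two subsets.\<close>

definition subset_prod :: "('a \<Rightarrow> ('n::finite) qubits_op) \<Rightarrow> 'a list \<Rightarrow> 'a set \<Rightarrow> 'n qubits_op" where
  "subset_prod g xs D = op_prod (map (\<lambda>x. if x \<in> D then g x else mat 1) xs)"

lemma subset_prod_Nil: "subset_prod g [] D = mat 1"
  and subset_prod_Cons:
    "subset_prod g (x # xs) D = (if x \<in> D then g x else mat 1) ** subset_prod g xs D"
  by (simp_all add: subset_prod_def op_prod_def)

lemma subset_prod_empty: "subset_prod g xs {} = mat 1"
  by (induction xs) (simp_all add: subset_prod_Nil subset_prod_Cons)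

lemma subset_prod_singleton:
  "distinct xs \<Longrightarrow> subset_prod g xs {x} = (if x \<in> set xs then g x else mat 1)"
  by (induction xs) (auto simp: subset_prod_Nil subset_prod_Cons)

lemma commuting_subset_prod:
  "(\<And>x. x \<in> set xs \<Longrightarrow> commuting A (g x)) \<Longrightarrow> commuting A (subset_prod g xs D)"
  unfolding subset_prod_def by (rule commuting_op_prod) (auto simp: commuting_one)

text \<open>Commuting involutions can be rearranged, and those occurring in both products
  cancel.\<close>

lemma subset_prod_mult:
  assumes "\<And>x y. x \<in> set xs \<Longrightarrow> y \<in> set xs \<Longrightarrow> commuting (g x) (g y)"
    and "\<And>x. x \<in> set xs \<Longrightarrow> g x ** g x = mat 1"
  shows "subset_prod g xs D ** subset_prod g xs E = subset_prod g xs (sym_diff D E)"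
  using assms
proof (induction xs)
  case (Cons x xs)
  let ?p = "subset_prod g xs D" and ?q = "subset_prod g xs E"
  let ?a = "if x \<in> D then g x else mat 1" and ?b = "if x \<in> E then g x else mat 1"
  have "commuting ?b ?p"
    by (intro commuting_subset_prod) (simp add: Cons.prems(1) commuting_one)
  then have "(?a ** ?p) ** (?b ** ?q) = (?a ** ?b) ** (?p ** ?q)"
    by (intro matrix_mult_interchange commuting_sym[of "?b" "?p"])
  also have "?a ** ?b = (if x \<in> sym_diff D E then g x else mat 1)"
    by (simp add: Cons.prems(2))
  also have "?p ** ?q = subset_prod g xs (sym_diff D E)"
    by (intro Cons.IH Cons.prems) simp_all
  finally show ?case
    by (simp only: subset_prod_Cons)
qed (simp add: subset_prod_Nil)

text \<open>Multiplying by the involutions \<open>p\<close> and \<open>q\<close> once more recovers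
  \<open>U\<close> and \<open>V\<close>, and preserves commutation.\<close>

lemma commuting_cancel_right:
  assumes "commuting (U ** p) (V ** q)" "commuting p V" "commuting p q" "commuting q U"
    and "p ** p = mat 1" "q ** q = mat 1"
  shows "commuting U V"
proof -
  have "commuting ((U ** p) ** p) (V ** q)"
    by (intro commuting_mult_left assms(1) commuting_mult_right assms(2,3))
  moreover have "(U ** p) ** p = U"
    using assms(5) by (simp flip: matrix_mul_assoc)
  ultimately have "commuting U ((V ** q) ** q)"
    using commuting_mult_right commuting_sym[OF assms(4)] by metis
  moreover have "(V ** q) ** q = V"
    using assms(6) by (simp flip: matrix_mul_assoc)
  ultimately show ?thesis by simp
qed

text \<open>Induction on the tree. Here \<open>W\<close> collects the possible prefactors
  \<open>U\<close>; commuting elements of \<open>W\<close> have their product in \<open>W\<close>,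
  and siblings commute, so the form survives at each parent.\<close>

lemma determining_tree_over_normal_form:
  fixes g w :: "('n::finite) qubits_op \<Rightarrow> 'n qubits_op" and W :: "'n qubits_op set"
  assumes xs: "distinct xs" "set xs = S"
    and factor: "\<And>B. B \<in> S \<Longrightarrow> w B \<in> W \<and> B = w B ** g B"
    and gg: "\<And>B C. B \<in> S \<Longrightarrow> C \<in> S \<Longrightarrow> commuting (g B) (g C)"
    and g_square: "\<And>B. B \<in> S \<Longrightarrow> g B ** g B = mat 1"
    and Wg: "\<And>U B. U \<in> W \<Longrightarrow> B \<in> S \<Longrightarrow> commuting U (g B)"
    and W_one: "mat 1 \<in> W"
    and W_square: "\<And>U. U \<in> W \<Longrightarrow> U ** U = mat 1"
    and W_commuting: "\<And>U V. U \<in> W \<Longrightarrow> V \<in> W \<Longrightarrow> commuting U V \<Longrightarrow> U = mat 1 \<or> V = mat 1 \<or> U = V"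
    and tree: "determining_tree_over S \<tau>"
  shows "\<exists>U\<in>W. label \<tau> = U ** subset_prod g xs (determining_set \<tau>)"
  using tree
proof (induction \<tau>)
  case (Node A ts)
  let ?p = "subset_prod g xs"
  have p_mult: "?p D ** ?p E = ?p (sym_diff D E)" for D E
    using xs(2) gg g_square by (intro subset_prod_mult) simp_all
  have p_square: "?p D ** ?p D = mat 1" for D
    by (simp add: p_mult subset_prod_empty)
  have Wp: "commuting U (?p D)" if "U \<in> W" for U D
    using xs(2) Wg that by (intro commuting_subset_prod) simp_all
  have pp: "commuting (?p D) (?p E)" for D E
    by (simp add: commuting_def p_mult Un_commute)
  show ?case
  proof (cases "ts = []")
    case True
    then have "A \<in> S" using Node.prems by simp
    then have "?p {A} = g A"
      using xs by (simp add: subset_prod_singleton)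
    then show ?thesis
      using True factor[OF \<open>A \<in> S\<close>] by (auto simp: determining_set_conv odd_part_simps)
  next
    case False
    \<comment> \<open>Generalised to lists \<open>us\<close> of children, whose product need not
      label a node, so that the list induction goes through.\<close>
    have children: "\<exists>U\<in>W. op_prod (map label us) = U ** ?p (odd_part (sum_list (map leaves us)))"
      if "set us \<subseteq> set ts" for us
      using that
    proof (induction us)
      case Nil
      then show ?case
        using W_one by (auto simp: op_prod_def odd_part_simps subset_prod_empty)
    next
      case (Cons t us)
      let ?D = "odd_part (leaves t)" and ?E = "odd_part (sum_list (map leaves us))"
      have t: "t \<in> set ts" using Cons.prems by simp
      then have "determining_tree_over S t"
        using Node.prems False by (simp add: list_all_iff)
      then obtain U where U: "U \<in> W" "label t = U ** ?p ?D"
        using Node.IH[OF t] by (auto simp: determining_set_conv)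
      obtain V where V: "V \<in> W" "op_prod (map label us) = V ** ?p ?E"
        using Cons by auto
      have "commuting (label t) (op_prod (map label us))"
        by (rule commuting_op_prod) (use t Cons.prems Node.prems False in auto)
      \<comment> \<open>The first child commutes with the product of the others; stripping the
        \<open>g\<close> parts leaves the prefactors.\<close>
      then have UV: "commuting U V"
        unfolding U V
        by (rule commuting_cancel_right) (intro Wp[THEN commuting_sym] U V pp p_square)+
      have "op_prod (map label (t # us)) = (U ** V) ** (?p ?D ** ?p ?E)"
        using matrix_mult_interchange[OF commuting_sym[OF Wp[OF V(1)]]] U V
        by (simp add: op_prod_def)
      also have "?p ?D ** ?p ?E = ?p (odd_part (sum_list (map leaves (t # us))))"
        by (simp add: p_mult odd_part_simps)
      finally have "op_prod (map label (t # us))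
          = (U ** V) ** ?p (odd_part (sum_list (map leaves (t # us))))" .
      \<comment> \<open>One prefactor is the identity or both coincide, so the product is
        \<open>V\<close>, \<open>U\<close> or \<open>mat 1\<close>.\<close>
      moreover have "U ** V \<in> W"
        using W_commuting[OF U(1) V(1) UV] U(1) V(1) W_one W_square by auto
      ultimately show ?case by blast
    qed
    have "A = op_prod (map label ts)"
      using Node.prems False by simp
    then show ?thesis
      using children[of ts] False by (simp add: determining_set_conv)
  qed
qed

section \<open>Transitivity of commutation and noncontextuality\<close>

lemma mat_1_neq_uminus: "(mat 1 :: ('n::finite) qubits_op) \<noteq> - mat 1"
proof
  assume eq: "(mat 1 :: 'n qubits_op) = - mat 1"
  then show False
    using arg_cong[OF eq, of "\<lambda>M. M $ undefined $ undefined"] by (simp add: mat_def)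
qed

lemma remove_central_iff:
  "A \<in> remove_central S \<longleftrightarrow> A \<in> S \<and> (\<exists>B\<in>S. \<not> commuting A B)"
  by (auto simp: remove_central_def commuting_refl)

text \<open>Reflexivity and symmetry are automatic, so transitivity is the whole content.\<close>

lemma equiv_commutation_on_iff:
  "equiv T (commutation_on T) \<longleftrightarrow>
     (\<forall>A\<in>T. \<forall>B\<in>T. \<forall>C\<in>T. commuting A B \<longrightarrow> commuting B C \<longrightarrow> commuting A C)"
proof -
  have "commutation_on T \<subseteq> T \<times> T" "refl_on T (commutation_on T)" "sym (commutation_on T)"
    by (auto simp: commutation_on_def commuting_refl commuting_sym intro!: refl_onI symI)
  then have "equiv T (commutation_on T) \<longleftrightarrow> trans (commutation_on T)"
    by (simp add: equiv_def)
  then show ?thesis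
    by (auto simp: trans_def commutation_on_def)
qed

lemma transitive_noncontextual:
  fixes S :: "('n::finite) qubits_op set"
  assumes "finite S" and pauli: "\<forall>A\<in>S. pauli_operator A" and T: "T = remove_central S"
    and trans: "\<And>A B C. A \<in> T \<Longrightarrow> B \<in> T \<Longrightarrow> C \<in> T \<Longrightarrow>
      commuting A B \<Longrightarrow> commuting B C \<Longrightarrow> commuting A C"
  shows "noncontextual S"
proof
  assume "contextual S"
  then obtain A \<sigma> \<tau> where tree: "determining_tree_over S \<sigma>" "label \<sigma> = A"
      "determining_tree_over S \<tau>" "label \<tau> = - A" "determining_set \<sigma> = determining_set \<tau>"
    unfolding contextual_def determining_tree_def by blast
  obtain xs where xs: "distinct xs" "set xs = S"
    using finite_distinct_list[OF \<open>finite S\<close>] by blast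

  have TS: "B \<in> S" if "B \<in> T" for B
    using that by (simp add: T remove_central_iff)
  have square: "B ** B = mat 1" if "B \<in> S" for B
    using pauli that by (simp add: pauli_operator_square)
  have central: "commuting X B" "commuting B X" if "X \<in> S" "B \<in> S" "B \<notin> T" for X B
    using that commuting_sym by (auto simp: T remove_central_iff)

  define r where "r B = (SOME C. C \<in> T \<and> commuting B C)" for B
  have r: "r B \<in> T \<and> commuting B (r B)" if "B \<in> T" for B
    unfolding r_def by (rule someI[of _ B]) (simp add: that commuting_refl)
  have r_eq: "r B = r C" if "B \<in> T" "C \<in> T" "commuting B C" for B C
  proof -
    \<comment> \<open>Members of one class give \<open>SOME\<close> the same predicate, hence the
      same representative.\<close>
    have "(D \<in> T \<and> commuting B D) \<longleftrightarrow> (D \<in> T \<and> commuting C D)" for D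
      using that trans commuting_sym by meson
    then show ?thesis by (simp only: r_def)
  qed

  define w where "w B = (if B \<in> T then r B else mat 1)" for B
  define g where "g B = (if B \<in> T then r B ** B else B)" for B
  define W where "W = insert (mat 1) (r ` T)"

  \<comment> \<open>An \<open>X\<close> in \<open>T\<close> commutes with both or neither of
    \<open>B\<close> and \<open>r B\<close>, by transitivity; in the latter case the two signs
    cancel. An \<open>X\<close> outside \<open>T\<close> commutes with everything in
    \<open>S\<close>.\<close>
  have Sg: "commuting X (g B)" if X: "X \<in> S" and B: "B \<in> S" for X B
  proof (cases "B \<in> T")
    case False
    then show ?thesis using central(1)[OF X B] by (simp add: g_def)
  next
    case True
    have "commuting X (r B ** B)"
    proof (cases "X \<in> T \<and> \<not> commuting X B")
      case True
      then have X: "X \<in> T" "\<not> commuting X B" by simp_all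
      moreover have "\<not> commuting X (r B)"
        using X r[OF \<open>B \<in> T\<close>] trans \<open>B \<in> T\<close> commuting_sym by meson
      ultimately have "twisted (-1) X (r B)" "twisted (-1) X B"
        using pauli TS r[OF \<open>B \<in> T\<close>] \<open>B \<in> T\<close> pauli_operator_anticommute by meson+
      then show ?thesis
        using twisted_mult_right by (fastforce simp: commuting_iff_twisted)
    next
      case False
      then have "commuting X B" "commuting X (r B)"
        using trans r[OF \<open>B \<in> T\<close>] \<open>B \<in> T\<close> X B TS central(2) by meson+
      then show ?thesis by (rule commuting_mult_right[rotated])
    qed
    then show ?thesis using True by (simp add: g_def)
  qed
  have factor: "w B \<in> W \<and> B = w B ** g B" if "B \<in> S" for B
    using square[OF TS] r by (auto simp: w_def g_def W_def matrix_mul_assoc)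
  have gg: "commuting (g B) (g C)" if "B \<in> S" "C \<in> S" for B C
    using Sg TS r that by (auto simp: g_def[of B] intro!: commuting_mult_left)
  have g_square: "g B ** g B = mat 1" if "B \<in> S" for B
  proof (cases "B \<in> T")
    case True
    have "(r B ** B) ** (r B ** B) = (r B ** r B) ** (B ** B)"
      using r[OF True] by (intro matrix_mult_interchange) simp
    then show ?thesis using True r square TS by (simp add: g_def)
  qed (simp add: g_def square that)
  have Wg: "commuting U (g B)" if "U \<in> W" "B \<in> S" for U B
    using that Sg TS r by (auto simp: W_def commuting_one)
  have W_square: "U ** U = mat 1" if "U \<in> W" for U
    using that square TS r by (auto simp: W_def)
  have W_commuting: "U = mat 1 \<or> V = mat 1 \<or> U = V"
    if "U \<in> W" "V \<in> W" "commuting U V" for U V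
  proof -
    \<comment> \<open>The chain \<open>B\<close>, \<open>r B\<close>, \<open>r C\<close>,
      \<open>C\<close> of commuting operators puts \<open>B\<close> and \<open>C\<close> in one
      class.\<close>
    have "r B = r C" if "B \<in> T" "C \<in> T" "commuting (r B) (r C)" for B C
      using that r r_eq trans commuting_sym by meson
    then show ?thesis using that by (auto simp: W_def)
  qed
  \<comment> \<open>Representatives lie in \<open>T\<close>, but \<open>- mat 1\<close> commutes
    with every operator and so cannot.\<close>
  have neg_one: "- mat 1 \<notin> W"
  proof
    assume "- mat 1 \<in> W"
    then have "- mat 1 \<in> T" using r mat_1_neq_uminus by (auto simp: W_def)
    then show False
      by (simp add: T remove_central_iff commuting_def matrix_mult_uminus)
  qed

  let ?p = "subset_prod g xs (determining_set \<sigma>)"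
  have one: "mat 1 \<in> W" by (simp add: W_def)
  have normal_form: "\<exists>U\<in>W. label \<rho> = U ** subset_prod g xs (determining_set \<rho>)"
    if "determining_tree_over S \<rho>" for \<rho>
    by (rule determining_tree_over_normal_form
        [OF xs factor gg g_square Wg one W_square W_commuting that])
  obtain U where U: "U \<in> W" "A = U ** ?p"
    using normal_form[OF tree(1)] tree by auto
  obtain V where V: "V \<in> W" "- A = V ** ?p"
    using normal_form[OF tree(3)] tree by auto
  \<comment> \<open>Equal determining sets give both roots the same factor \<open>?p\<close>;
    cancelling it transfers the opposite signs to \<open>U\<close> and \<open>V\<close>.\<close>
  have "?p ** ?p = mat 1"
    using subset_prod_mult[of xs g] xs gg g_square by (simp add: subset_prod_empty)
  then have "U = A ** ?p" "V = - A ** ?p"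
    using U V by (simp_all flip: matrix_mul_assoc)
  then have V_eq: "V = - U"
    by (simp add: matrix_mult_uminus)
  then have "commuting U V"
    by (simp add: commuting_def matrix_mult_uminus)
  then consider "U = mat 1" | "V = mat 1" | "U = V"
    using W_commuting U V by blast
  then show False
  proof cases
    case 1
    then show ?thesis using V V_eq neg_one by simp
  next
    case 2
    then have "U = - mat 1" using V_eq by (metis minus_minus)
    then show ?thesis using U neg_one by simp
  next
    case 3
    then have "U ** U = - (U ** U)" using V_eq by (metis matrix_mult_uminus(1))
    then show ?thesis using W_square[OF U(1)] mat_1_neq_uminus by metis
  qed
qed

theorem theorem3:
  fixes S T :: "('n::finite) qubits_op set"
  assumes "finite S"
    and "\<forall>A\<in>S. pauli_operator A"
    and "T = remove_central S"
  shows "noncontextual S \<longleftrightarrow> equiv T (commutation_on T)"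
proof
  assume "noncontextual S"
  show "equiv T (commutation_on T)"
    unfolding equiv_commutation_on_iff
  proof (intro ballI impI)
    fix A B C
    assume *: "A \<in> T" "B \<in> T" "C \<in> T" "commuting A B" "commuting B C"
    \<comment> \<open>Since \<open>B\<close> survives in \<open>T\<close>, some \<open>D\<close>
      fails to commute with it.\<close>
    then obtain D where "D \<in> S" "\<not> commuting B D"
      using assms(3) by (auto simp: remove_central_iff)
    then show "commuting A C"
      using * \<open>noncontextual S\<close> assms intransitive_contextual[of S A B C D]
      by (auto simp: remove_central_iff)
  qed
next
  assume "equiv T (commutation_on T)"
  then show "noncontextual S"
    unfolding equiv_commutation_on_iff
    by (intro transitive_noncontextual[OF assms]) blast
qed

end
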